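(* Let $1<a\le 2$ and let $\varphi$ be the function defined by $\varphi\left(\sum_{n=1}^{\infty}\frac{\alpha_n}{2^n}\right)=\sum_{n=1}^{\infty}\frac{\alpha_n}{a^n}$, where $(\alpha_n)$, $\alpha_n\in\{0,1\}$, is the binary expansion of the argument in $[0,1)$ that does not end in an infinite string of $1$s. Then $$\int_0^1\varphi(x)\,dx=\frac{1}{2(a-1)}.$$
   Context: Every $x\in[0,1)$ has a unique binary expansion $x=\sum_{n\ge1}\alpha_n2^{-n}$ with $\alpha_n\in\{0,1\}$ that is not eventually equal to $1$; this is the expansion used to define $\varphi(x)$. The value at the single point $x=1$ is irrelevant to the integral. *)

theory Defs
  imports "HOL-Analysis.Analysis"
begin

text \<open>Digit sequences are indexed from 0, so \<open>\<alpha> n\<close> is the coefficient of \<open>2 ^ -(n + 1)\<close>.\<close>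

definition is_binary_expansion :: "(nat \<Rightarrow> nat) \<Rightarrow> real \<Rightarrow> bool" where
  "is_binary_expansion \<alpha> x \<longleftrightarrow>
     (\<forall>n. \<alpha> n \<in> {0, 1}) \<and>
     \<not> (\<forall>\<^sub>F n in sequentially. \<alpha> n = 1) \<and>
     (\<lambda>n. real (\<alpha> n) / 2 ^ Suc n) sums x"

text \<open>Exactly the points of \<open>[0, 1)\<close> have such an expansion, and it is then unique;
  outside \<open>[0, 1)\<close> the following two functions have unspecified values.\<close>

definition binary_digits :: "real \<Rightarrow> nat \<Rightarrow> nat" where
  "binary_digits x = (THE \<alpha>. is_binary_expansion \<alpha> x)"

definition phi :: "real \<Rightarrow> real \<Rightarrow> real" where
  "phi a x = (\<Sum>n. real (binary_digits x n) / a ^ Suc n)"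

end

theory Submission
  imports Defs
begin

text \<open>Complementing the digits is the reflection \<open>x \<mapsto> 1 - x\<close> away from the dyadic rationals, so
  \<open>\<phi>(x) + \<phi>(1 - x) = (\<Sum>n. 1 / a ^ Suc n) = 1 / (a - 1)\<close> almost everywhere. Integrating this over
  \<open>[0, 1]\<close>, where both summands have the same integral, gives the claim.\<close>

section \<open>Binary digits as differences of floors\<close>

definition floor_digit :: "real \<Rightarrow> nat \<Rightarrow> nat" where
  "floor_digit x n = nat (\<lfloor>2 ^ Suc n * x\<rfloor> - 2 * \<lfloor>2 ^ n * x\<rfloor>)"

lemma floor_double_diff: "\<lfloor>2 * y\<rfloor> - 2 * \<lfloor>y\<rfloor> \<in> {0, 1}" for y :: real
proof -
  have "\<lfloor>2 * y\<rfloor> = 2 * \<lfloor>y\<rfloor> \<or> \<lfloor>2 * y\<rfloor> = 2 * \<lfloor>y\<rfloor> + 1"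
    by linarith
  then show ?thesis by auto
qed

text \<open>The difference is 0 or 1, so \<open>nat\<close> truncates nothing and floor identities
  can be used over the integers.\<close>

lemma int_floor_digit: "int (floor_digit x n) = \<lfloor>2 ^ Suc n * x\<rfloor> - 2 * \<lfloor>2 ^ n * x\<rfloor>"
  using floor_double_diff[of "2 ^ n * x"] by (auto simp: floor_digit_def mult.assoc)

lemma floor_digit_bin: "floor_digit x n \<in> {0, 1}"
  using floor_double_diff[of "2 ^ n * x"] by (auto simp: floor_digit_def mult.assoc)

text \<open>The two floors drop by \<open>2 ^ Suc n * m\<close> and \<open>2 ^ n * m\<close>, and
  the factor 2 cancels these shifts. It lets a leading digit be removed in the uniqueness
  proof.\<close>

lemma floor_digit_diff_of_nat: "floor_digit (x - of_nat m) n = floor_digit x n"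
proof -
  have "\<lfloor>2 ^ k * (x - of_nat m)\<rfloor> = \<lfloor>2 ^ k * x\<rfloor> - 2 ^ k * int m" for k
    using floor_diff_of_int[of "2 ^ k * x" "2 ^ k * int m"] by (simp add: algebra_simps)
  then show ?thesis
    by (simp only: floor_digit_def) simp
qed

section \<open>Uniqueness of the expansion\<close>

lemma is_binary_expansion_bounds:
  assumes "is_binary_expansion \<alpha> x"
  shows "0 \<le> x" "x < 1"
proof -
  have bin: "\<alpha> n \<in> {0, 1}" for n
    using assms by (auto simp: is_binary_expansion_def)
  have s: "(\<lambda>n. real (\<alpha> n) / 2 ^ Suc n) sums x"
    using assms by (auto simp: is_binary_expansion_def)
  have le: "real (\<alpha> n) \<le> 1" for n
    using bin[of n] by auto
  show "0 \<le> x"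
    by (rule sums_le[OF _ sums_zero s]) simp
  have g: "(\<lambda>n. (1::real) / 2 ^ Suc n) sums 1"
    using power_half_series by (simp add: power_divide)
  \<comment> \<open>Since the digits are not eventually 1, some digit is 0. It contributes a
    strictly positive term to the series for \<open>1 - x\<close>, which makes the upper bound
    strict.\<close>
  obtain k where k: "\<alpha> k \<noteq> 1"
    using assms by (auto simp: is_binary_expansion_def eventually_sequentially)
  have d: "(\<lambda>n. 1 / 2 ^ Suc n - real (\<alpha> n) / 2 ^ Suc n) sums (1 - x)"
    by (rule sums_diff[OF g s])
  have "0 < (\<Sum>n. 1 / 2 ^ Suc n - real (\<alpha> n) / 2 ^ Suc n)"
  proof (rule suminf_pos2[of _ k])
    show "0 < 1 / 2 ^ Suc k - real (\<alpha> k) / 2 ^ Suc k"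
      using bin[of k] k by auto
  qed (use d le in \<open>auto simp: sums_iff divide_right_mono\<close>)
  then show "x < 1"
    using d by (simp add: sums_iff)
qed

text \<open>Dropping the first digit is the doubling map. The tail is again an admissible expansion,
  so the bounds above apply to it as well.\<close>

lemma is_binary_expansion_shift:
  assumes "is_binary_expansion \<alpha> x"
  shows "is_binary_expansion (\<lambda>n. \<alpha> (Suc n)) (2 * x - real (\<alpha> 0))"
proof -
  have s: "(\<lambda>n. real (\<alpha> n) / 2 ^ Suc n) sums x"
    using assms by (auto simp: is_binary_expansion_def)
  have "(\<lambda>n. real (\<alpha> (Suc n)) / 2 ^ Suc (Suc n)) sums (x - real (\<alpha> 0) / 2)"
    using s sums_Suc_iff[of "\<lambda>n. real (\<alpha> n) / 2 ^ Suc n" "x - real (\<alpha> 0) / 2"] by simp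
  from sums_mult[OF this, of 2]
  have "(\<lambda>n. real (\<alpha> (Suc n)) / 2 ^ Suc n) sums (2 * x - real (\<alpha> 0))"
    by (simp add: right_diff_distrib)
  then show ?thesis
    using assms eventually_sequentially_Suc[of "\<lambda>n. \<alpha> n = 1"]
    by (simp add: is_binary_expansion_def)
qed

lemma is_binary_expansion_unique:
  assumes "is_binary_expansion \<alpha> x"
  shows "\<alpha> n = floor_digit x n"
  using assms
proof (induction n arbitrary: \<alpha> x)
  case 0
  have "\<lfloor>x\<rfloor> = 0"
    using is_binary_expansion_bounds[OF 0] by linarith
  \<comment> \<open>The shifted expansion places \<open>2 * x - real (\<alpha> 0)\<close> in [0,
    1).\<close>
  moreover have "\<lfloor>2 * x\<rfloor> = int (\<alpha> 0)"
    using is_binary_expansion_bounds[OF is_binary_expansion_shift[OF 0]] by linarith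
  ultimately show ?case
    by (simp add: floor_digit_def)
next
  case (Suc n)
  have "\<alpha> (Suc n) = floor_digit (2 * x - real (\<alpha> 0)) n"
    using Suc.IH[OF is_binary_expansion_shift[OF Suc.prems]] .
  also have "\<dots> = floor_digit (2 * x) n"
    by (rule floor_digit_diff_of_nat)
  also have "\<dots> = floor_digit x (Suc n)"
    by (simp add: floor_digit_def mult_ac)
  finally show ?case .
qed

section \<open>Existence of the expansion\<close>

lemma floor_digit_not_eventually_1: "\<not> (\<forall>\<^sub>F n in sequentially. floor_digit x n = 1)"
proof
  assume "\<forall>\<^sub>F n in sequentially. floor_digit x n = 1"
  then obtain m where m: "\<And>n. m \<le> n \<Longrightarrow> floor_digit x n = 1"
    by (auto simp: eventually_sequentially)
  \<comment> \<open>A digit 1 doubles the distance of \<open>2 ^ n * x\<close> to the next integer, which stays at most 1.\<close>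
  define r where "r n = 1 - frac (2 ^ n * x)" for n
  have step: "r (Suc n) = 2 * r n" if "m \<le> n" for n
    using int_floor_digit[of x n] m[OF that] by (simp add: r_def frac_def)
  have pow: "r (m + k) = 2 ^ k * r m" for k
    by (induction k) (simp_all add: step)
  have pos: "0 < r m"
    using frac_lt_1[of "2 ^ m * x"] by (simp add: r_def)
  obtain k where "1 / r m < 2 ^ k"
    using real_arch_pow[of 2 "1 / r m"] by auto
  then have "1 < r (m + k)"
    unfolding pow using pos by (simp add: field_simps)
  then show False
    using frac_ge_0[of "2 ^ (m + k) * x"] by (simp add: r_def)
qed

lemma is_binary_expansion_floor_digit:
  assumes "0 \<le> x" "x < 1"
  shows "is_binary_expansion (floor_digit x) x"
proof -
  \<comment> \<open>The sum telescopes: its k-th term is the difference of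
    \<open>\<lfloor>2 ^ k * x\<rfloor> / 2 ^ k\<close> at \<open>Suc k\<close> and at
    \<open>k\<close>, and the initial value is 0 because x lies in [0, 1).\<close>
  have partial: "(\<Sum>k<n. real (floor_digit x k) / 2 ^ Suc k) = \<lfloor>2 ^ n * x\<rfloor> / 2 ^ n" for n
  proof (induction n)
    case 0
    have "\<lfloor>x\<rfloor> = 0" using assms by linarith
    then show ?case by simp
  next
    case (Suc n)
    have "real (floor_digit x n) = \<lfloor>2 ^ Suc n * x\<rfloor> - 2 * \<lfloor>2 ^ n * x\<rfloor>"
      using int_floor_digit[of x n] by linarith
    then show ?case
      using Suc.IH by (simp add: field_simps)
  qed
  have "(\<lambda>n. \<lfloor>2 ^ n * x\<rfloor> / 2 ^ n) \<longlonglongrightarrow> x"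
  proof (rule tendsto_sandwich)
    show "\<forall>\<^sub>F n in sequentially. x - (1 / 2) ^ n \<le> \<lfloor>2 ^ n * x\<rfloor> / 2 ^ n"
    proof (rule always_eventually, rule allI)
      fix n :: nat
      have "x - (1 / 2) ^ n = (2 ^ n * x - 1) / 2 ^ n"
        by (simp add: diff_divide_distrib power_divide)
      also have "\<dots> \<le> \<lfloor>2 ^ n * x\<rfloor> / 2 ^ n"
        by (intro divide_right_mono) (linarith, simp)
      finally show "x - (1 / 2) ^ n \<le> \<lfloor>2 ^ n * x\<rfloor> / 2 ^ n" .
    qed
    show "\<forall>\<^sub>F n in sequentially. \<lfloor>2 ^ n * x\<rfloor> / 2 ^ n \<le> x"
    proof (rule always_eventually, rule allI)
      fix n :: nat
      show "\<lfloor>2 ^ n * x\<rfloor> / 2 ^ n \<le> x"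
        by (simp add: pos_divide_le_eq mult.commute)
    qed
    have "(\<lambda>n. (1 / 2 :: real) ^ n) \<longlonglongrightarrow> 0"
      by (rule LIMSEQ_realpow_zero) auto
    from tendsto_diff[OF tendsto_const this, of x]
    show "(\<lambda>n. x - (1 / 2) ^ n) \<longlonglongrightarrow> x" by simp
  qed simp
  then have "(\<lambda>n. real (floor_digit x n) / 2 ^ Suc n) sums x"
    unfolding sums_def partial .
  then show ?thesis
    using floor_digit_bin floor_digit_not_eventually_1 by (auto simp: is_binary_expansion_def)
qed

text \<open>Existence and uniqueness together resolve the \<open>THE\<close>; from here on only the
  floor formula matters on [0, 1).\<close>

lemma binary_digits_eq:
  assumes "0 \<le> x" "x < 1"
  shows "binary_digits x = floor_digit x"
  unfolding binary_digits_def
proof (rule the_equality)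
  show "is_binary_expansion (floor_digit x) x"
    by (rule is_binary_expansion_floor_digit[OF assms])
  show "\<alpha> = floor_digit x" if "is_binary_expansion \<alpha> x" for \<alpha>
    using is_binary_expansion_unique[OF that] by (rule ext)
qed

section \<open>Complementary digits under reflection, almost everywhere\<close>

lemma floor_digit_reflect:
  assumes "2 ^ n * x \<notin> \<int>" "2 ^ Suc n * x \<notin> \<int>"
  shows "floor_digit x n + floor_digit (1 - x) n = 1"
proof -
  have refl: "\<lfloor>2 ^ k * (1 - x)\<rfloor> = 2 ^ k - 1 - \<lfloor>2 ^ k * x\<rfloor>" if "2 ^ k * x \<notin> \<int>" for k
  proof -
    have "\<lfloor>2 ^ k * x\<rfloor> < 2 ^ k * x"
      using that by (metis Ints_of_int of_int_floor_le order_le_less)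
    then have "\<lfloor>of_int (2 ^ k) - 2 ^ k * x\<rfloor> = 2 ^ k - 1 - \<lfloor>2 ^ k * x\<rfloor>"
      by linarith
    then show ?thesis by (simp add: right_diff_distrib)
  qed
  \<comment> \<open>The floors of x cancel, and what remains is
    \<open>(2 ^ Suc n - 1) - 2 * (2 ^ n - 1) = 1\<close>.\<close>
  have "int (floor_digit x n + floor_digit (1 - x) n) = 1"
    unfolding of_nat_add int_floor_digit refl[OF assms(1)] refl[OF assms(2)] by simp
  then show ?thesis by linarith
qed

text \<open>For each fixed n the exceptional points are integers divided by \<open>2 ^ n\<close>, a
  countable and hence null set; there are only countably many n.\<close>

lemma AE_not_dyadic: "AE x in lborel. \<forall>n. 2 ^ n * x \<notin> (\<int> :: real set)"
  unfolding AE_all_countable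
proof
  fix n :: nat
  have "{x :: real. 2 ^ n * x \<in> \<int>} \<subseteq> (\<lambda>z. z / 2 ^ n) ` \<int>"
    by (auto intro!: image_eqI)
  then have "countable {x :: real. 2 ^ n * x \<in> \<int>}"
    by (rule countable_subset) (simp add: Ints_def)
  then show "AE x in lborel. 2 ^ n * x \<notin> (\<int> :: real set)"
    by (intro AE_I'[OF countable_imp_null_set_lborel]) auto
qed

section \<open>Geometric bounds and integrability\<close>

lemma sums_inverse_powers:
  fixes a :: real
  assumes "1 < a"
  shows "(\<lambda>n. 1 / a ^ Suc n) sums (1 / (a - 1))"
proof -
  have "(\<lambda>n. (1 / a) * (1 / a) ^ n) sums ((1 / a) * (1 / (1 - 1 / a)))"
    using assms by (intro sums_mult geometric_sums) simp
  moreover have "(1 / a) * (1 / (1 - 1 / a)) = 1 / (a - 1)"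
    using assms by (simp add: field_simps)
  ultimately show ?thesis
    by (simp add: power_divide)
qed

text \<open>Comparison with the geometric series of all digits 1. The bound is uniform in x, as
  integrability over a bounded interval requires.\<close>

lemma floor_digit_series_bounds:
  fixes a :: real
  assumes "1 < a"
  shows "summable (\<lambda>n. real (floor_digit x n) / a ^ Suc n)"
    and "\<bar>\<Sum>n. real (floor_digit x n) / a ^ Suc n\<bar> \<le> 1 / (a - 1)"
proof -
  have le: "real (floor_digit x n) / a ^ Suc n \<le> 1 / a ^ Suc n" for n
    using floor_digit_bin[of x n] assms by auto
  have nonneg: "0 \<le> real (floor_digit x n) / a ^ Suc n" for n
    using assms by simp
  note g = sums_inverse_powers[OF assms]
  show s: "summable (\<lambda>n. real (floor_digit x n) / a ^ Suc n)"
    by (rule summable_comparison_test'[OF sums_summable[OF g]])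
      (unfold real_norm_def abs_of_nonneg[OF nonneg], rule le)
  have "(\<Sum>n. real (floor_digit x n) / a ^ Suc n) \<le> 1 / (a - 1)"
    by (rule sums_le[OF le summable_sums[OF s] g])
  then show "\<bar>\<Sum>n. real (floor_digit x n) / a ^ Suc n\<bar> \<le> 1 / (a - 1)"
    using suminf_nonneg[OF s nonneg] by simp
qed

lemma phi_reflect:
  fixes a :: real
  assumes "1 < a" "0 < x" "x < 1" "\<And>n. 2 ^ n * x \<notin> \<int>"
  shows "phi a x + phi a (1 - x) = 1 / (a - 1)"
proof -
  have "phi a x + phi a (1 - x)
      = (\<Sum>n. real (floor_digit x n) / a ^ Suc n + real (floor_digit (1 - x) n) / a ^ Suc n)"
    using assms(2,3) by (simp add: phi_def binary_digits_eq suminf_add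
        floor_digit_series_bounds(1)[OF assms(1), simplified])
  also have "\<dots> = (\<Sum>n. 1 / a ^ Suc n)"
  proof (rule suminf_cong)
    fix n
    have "real (floor_digit x n) + real (floor_digit (1 - x) n) = 1"
      using floor_digit_reflect[OF assms(4) assms(4), of n] by linarith
    then show "real (floor_digit x n) / a ^ Suc n + real (floor_digit (1 - x) n) / a ^ Suc n
        = 1 / a ^ Suc n"
      by (metis add_divide_distrib)
  qed
  also have "\<dots> = 1 / (a - 1)"
    using sums_inverse_powers[OF assms(1)] by (rule sums_unique[symmetric])
  finally show ?thesis .
qed

lemma set_integrable_phi:
  fixes a :: real
  assumes "1 < a"
  shows "set_integrable lborel {0..1} (phi a)"
proof -
  \<comment> \<open>Measurability is read off the floor formula, since \<open>phi\<close> itself is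
    defined through a \<open>THE\<close>.\<close>
  have [measurable]: "(\<lambda>x. \<Sum>n. real (floor_digit x n) / a ^ Suc n) \<in> borel_measurable borel"
    unfolding floor_digit_def by measurable
  \<comment> \<open>At the endpoint 1 the value of \<open>phi\<close> is unspecified. It is kept as
    a constant, and its absolute value is added to the bound.\<close>
  have "set_integrable lborel {0..1}
      (\<lambda>x. if x = 1 then phi a 1 else \<Sum>n. real (floor_digit x n) / a ^ Suc n)"
    unfolding set_integrable_def
  proof (rule integrableI_bounded_set_indicator[where B = "\<bar>phi a 1\<bar> + 1 / (a - 1)"])
    show "AE x in lborel. x \<in> {0..1} \<longrightarrow>
        norm (if x = 1 then phi a 1 else \<Sum>n. real (floor_digit x n) / a ^ Suc n)
          \<le> \<bar>phi a 1\<bar> + 1 / (a - 1)"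
      using floor_digit_series_bounds(2)[OF assms] assms
      by (intro always_eventually) (auto intro: add_increasing)
  qed (auto simp: emeasure_lborel_Icc_eq)
  moreover have "(if x = 1 then phi a 1 else \<Sum>n. real (floor_digit x n) / a ^ Suc n) = phi a x"
    if "x \<in> {0..1}" for x
    using that by (auto simp: phi_def binary_digits_eq)
  ultimately show ?thesis
    by (rule set_integrable_cong[OF refl refl, THEN iffD1, rotated])
qed

theorem theorem5:
  fixes a :: real
  assumes "1 < a" and "a \<le> 2"
  shows "set_integrable lborel {0..1} (phi a) \<and>
         (LBINT x:{0..1}. phi a x) = 1 / (2 * (a - 1))"
proof
  show int: "set_integrable lborel {0..1} (phi a)"
    by (rule set_integrable_phi[OF assms(1)])
  \<comment> \<open>Cutting off to [0, 1], an interval symmetric about 1/2, turns the reflection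
    into a substitution on the whole line.\<close>
  define f where "f x = indicator {0..1} x *\<^sub>R phi a x" for x :: real
  have f: "integrable lborel f"
    using int by (simp add: f_def[abs_def] set_integrable_def)
  have f': "integrable lborel (\<lambda>x. f (1 - x))"
    \<comment> \<open>The affine map has slope -1 and offset 1, so its Jacobian factor is 1.\<close>
    using lborel_integrable_real_affine[OF f, of "-1" 1] by simp
  have refl: "(\<integral>x. f (1 - x) \<partial>lborel) = (\<integral>x. f x \<partial>lborel)"
    using lborel_integral_real_affine[of "-1" f 1] by simp
  have "2 * (\<integral>x. f x \<partial>lborel) = (\<integral>x. f x + f (1 - x) \<partial>lborel)"
    by (simp add: f f' refl)
  also have "\<dots> = (\<integral>x. indicator {0..1::real} x *\<^sub>R (1 / (a - 1)) \<partial>lborel)"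
  proof (rule integral_cong_AE)
    show "AE x in lborel. f x + f (1 - x) = indicator {0..1} x *\<^sub>R (1 / (a - 1))"
      using AE_not_dyadic
    proof eventually_elim
      case (elim x)
      \<comment> \<open>The case n = 0 excludes both endpoints. Inside the interval
        \<open>phi_reflect\<close> applies; outside it both summands vanish.\<close>
      have "x \<noteq> 0" "x \<noteq> 1"
        using elim[rule_format, of 0] by auto
      then show ?case
        using phi_reflect[OF assms(1), of x] elim by (auto simp: f_def indicator_def)
    qed
  qed (use f f' in \<open>auto intro: borel_measurable_add\<close>)
  also have "\<dots> = 1 / (a - 1)"
    by simp
  finally show "(LBINT x:{0..1}. phi a x) = 1 / (2 * (a - 1))"
    using assms(1) by (simp add: set_lebesgue_integral_def f_def field_simps)
qed

end
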